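(* Let $n\ge 2$ and consider a normal generalized braid theory with finite set of tags $T$ and dominant tag $x\in T$. Let $gB_n$ be its braid group on $n$ strands and $gPB_n=\ker(\pi_n: gB_n\to S_n)$ its pure braid group. Then $gPB_n$ is generated by $$\mathcal{S}=\{\, {}_{a}\lambda_{i,j},\ {}_{a}\lambda_{j,i},\ {}_{x}\lambda_{i,j} \ \mid\ 1\le i<j\le n,\ a \text{ any tag other than } x \,\}.$$
   Context: **Generalized braid theory.** Fix a finite set $T$ of tags (crossing types). Each tag $a$ has a negative version $\bar a$ (with $\bar{\bar a}=a$; possibly $\bar a=a$). A generalized braid diagram on $n$ strands is a union of $n$ monotonic strands in $\mathbb{R}\times[0,1]$ with boundary $Q_n\times\{0,1\}$ ($Q_n\subset\mathbb{R}$ a set of $n$ points), whose crossings are finitely many transverse double points, each labelled by some $a$ or $\bar a$, considered up to planar isotopy fixing the end points. Write $a_i$, $\bar a_i$ ($1\le i\le n-1$) for the diagram with a single crossing, between positions $i$ and $i+1$, labelled $a$, resp. $\bar a$. Every diagram is a product (concatenation) of such elementary diagrams; planar isotopy gives $a_ib_j=b_ja_i$ for $|i-j|>1$ and all labels $a,b$. A braid theory specifies which of the following R-moves are allowed: $R_2(a)$: $a_i\bar a_i=1=\bar a_ia_i$; third moves, for specified triples of labels $a,b,c$: $a_ib_{i+1}c_i=c_{i+1}b_ia_{i+1}$; possibly commutation moves, for specified pairs of labels: $a_ib_i=b_ia_i$ (each for all admissible $i$). A braid is an equivalence class of diagrams under allowed moves. The theory is regular if $R_2(a)$ is allowed for every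 tag $a$; then the braids on $n$ strands form a group $gB_n$ under concatenation, with $\bar a_i=a_i^{-1}$. It is normal if it is regular and has a dominant tag $x$, meaning that for all labels $a$ (including $a=x$) and $1\le i\le n-2$, $$x_ix_{i+1}a_i=a_{i+1}x_ix_{i+1},\qquad x_{i+1}x_ia_{i+1}=a_ix_{i+1}x_i .$$ So $gB_n$ is the group generated by all $a_i$ ($a\in T$, $1\le i\le n-1$), with relations the far commutations and those of the allowed moves. **Pure braids.** $\pi_n:gB_n\to S_n$ sends each $a_i$ to the transposition $(i\ i+1)$; its kernel is $gPB_n$. **The elements $\lambda$.** For $a\in T$, $a\neq x$, and $1\le i\le n-1$: ${}_a\lambda_{i,i+1}=a_ix_i$, ${}_a\lambda_{i+1,i}=x_ia_i$, ${}_x\lambda_{i,i+1}=x_i^2$. For $1\le i<j\le n$ with $j\ne i+1$, put $w=x_{i+1}x_{i+2}\cdots x_{j-1}$ and ${}_a\lambda_{i,j}=w^{-1}\,{}_a\lambda_{i,i+1}\,w$, ${}_a\lambda_{j,i}=w^{-1}\,{}_a\lambda_{i+1,i}\,w$, ${}_x\lambda_{i,j}=w^{-1}\,{}_x\lambda_{i,i+1}\,w$. *)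

theory Defs
  imports "HOL-Algebra.Generated_Groups" "HOL-Algebra.Sym_Groups"
begin

text \<open>
  The type \<open>'a\<close> contains the crossing labels, the map \<open>bar\<close> sends a label to its negative version,
  and the remaining fields list the allowed moves: \<open>R2\<close> the tags \<open>a\<close> for which \<open>R\<^sub>2(a)\<close> is allowed,
  \<open>R3\<close> the label triples of allowed third moves, and \<open>RC\<close> the label pairs of allowed
  commutation moves.
\<close>

record 'a braid_theory =
  tags :: "'a set"
  bar :: "'a \<Rightarrow> 'a"
  R2 :: "'a set"
  R3 :: "('a \<times> 'a \<times> 'a) set"
  RC :: "('a \<times> 'a) set"

definition labels :: "('a, 'm) braid_theory_scheme \<Rightarrow> 'a set" where
  "labels \<Theta> = tags \<Theta> \<union> bar \<Theta> ` tags \<Theta>"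

definition generalized_braid_theory :: "('a, 'm) braid_theory_scheme \<Rightarrow> bool" where
  "generalized_braid_theory \<Theta> \<longleftrightarrow>
     finite (tags \<Theta>) \<and> (\<forall>a\<in>tags \<Theta>. bar \<Theta> (bar \<Theta> a) = a) \<and>
     R2 \<Theta> \<subseteq> tags \<Theta> \<and>
     R3 \<Theta> \<subseteq> labels \<Theta> \<times> labels \<Theta> \<times> labels \<Theta> \<and>
     RC \<Theta> \<subseteq> labels \<Theta> \<times> labels \<Theta>"

definition regular :: "('a, 'm) braid_theory_scheme \<Rightarrow> bool" where
  "regular \<Theta> \<longleftrightarrow> tags \<Theta> \<subseteq> R2 \<Theta>"

text \<open>
  Diagrams on \<open>n\<close> strands are encoded as words in the elementary diagrams: the letter \<open>(a, i)\<close>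
  is the diagram with a single crossing, between the positions \<open>i\<close> and \<open>i + 1\<close>, labelled \<open>a\<close>.
\<close>

definition diagrams :: "('a, 'm) braid_theory_scheme \<Rightarrow> nat \<Rightarrow> ('a \<times> nat) list set" where
  "diagrams \<Theta> n = lists (labels \<Theta> \<times> {1..<n})"

text \<open>The rule \<open>far\<close> is planar isotopy; the other rules are the R-moves the theory allows.\<close>

inductive_set elementary_moves ::
  "('a, 'm) braid_theory_scheme \<Rightarrow> nat \<Rightarrow> (('a \<times> nat) list \<times> ('a \<times> nat) list) set"
  for \<Theta> :: "('a, 'm) braid_theory_scheme" and n :: nat where
  far: "\<lbrakk>a \<in> labels \<Theta>; b \<in> labels \<Theta>; i \<in> {1..<n}; j \<in> {1..<n}; i + 1 < j \<or> j + 1 < i\<rbrakk>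
    \<Longrightarrow> ([(a, i), (b, j)], [(b, j), (a, i)]) \<in> elementary_moves \<Theta> n"
| R2_left: "\<lbrakk>a \<in> R2 \<Theta>; i \<in> {1..<n}\<rbrakk>
    \<Longrightarrow> ([(a, i), (bar \<Theta> a, i)], []) \<in> elementary_moves \<Theta> n"
| R2_right: "\<lbrakk>a \<in> R2 \<Theta>; i \<in> {1..<n}\<rbrakk>
    \<Longrightarrow> ([(bar \<Theta> a, i), (a, i)], []) \<in> elementary_moves \<Theta> n"
| R3: "\<lbrakk>(a, b, c) \<in> R3 \<Theta>; 1 \<le> i; i + 2 \<le> n\<rbrakk>
    \<Longrightarrow> ([(a, i), (b, i + 1), (c, i)], [(c, i + 1), (b, i), (a, i + 1)]) \<in> elementary_moves \<Theta> n"
| RC: "\<lbrakk>(a, b) \<in> RC \<Theta>; i \<in> {1..<n}\<rbrakk>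
    \<Longrightarrow> ([(a, i), (b, i)], [(b, i), (a, i)]) \<in> elementary_moves \<Theta> n"

inductive_set braid_rel ::
  "('a, 'm) braid_theory_scheme \<Rightarrow> nat \<Rightarrow> (('a \<times> nat) list \<times> ('a \<times> nat) list) set"
  for \<Theta> :: "('a, 'm) braid_theory_scheme" and n :: nat where
  move: "\<lbrakk>(p, q) \<in> elementary_moves \<Theta> n; u \<in> diagrams \<Theta> n; v \<in> diagrams \<Theta> n\<rbrakk>
    \<Longrightarrow> (u @ p @ v, u @ q @ v) \<in> braid_rel \<Theta> n"
| refl: "u \<in> diagrams \<Theta> n \<Longrightarrow> (u, u) \<in> braid_rel \<Theta> n"
| sym: "(u, v) \<in> braid_rel \<Theta> n \<Longrightarrow> (v, u) \<in> braid_rel \<Theta> n"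
| trans: "\<lbrakk>(u, v) \<in> braid_rel \<Theta> n; (v, w) \<in> braid_rel \<Theta> n\<rbrakk> \<Longrightarrow> (u, w) \<in> braid_rel \<Theta> n"

definition braid :: "('a, 'm) braid_theory_scheme \<Rightarrow> nat \<Rightarrow> ('a \<times> nat) list \<Rightarrow> ('a \<times> nat) list set" where
  "braid \<Theta> n w = braid_rel \<Theta> n `` {w}"

definition gB :: "('a, 'm) braid_theory_scheme \<Rightarrow> nat \<Rightarrow> ('a \<times> nat) list set monoid" where
  "gB \<Theta> n =
     \<lparr>carrier = diagrams \<Theta> n // braid_rel \<Theta> n,
      mult = (\<lambda>P Q. \<Union>u\<in>P. \<Union>v\<in>Q. braid \<Theta> n (u @ v)),
      one = braid \<Theta> n []\<rparr>"

definition crossing :: "('a, 'm) braid_theory_scheme \<Rightarrow> nat \<Rightarrow> 'a \<Rightarrow> nat \<Rightarrow> ('a \<times> nat) list set" where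
  "crossing \<Theta> n a i = braid \<Theta> n [(a, i)]"

definition dominant :: "('a, 'm) braid_theory_scheme \<Rightarrow> nat \<Rightarrow> 'a \<Rightarrow> bool" where
  "dominant \<Theta> n x \<longleftrightarrow> x \<in> tags \<Theta> \<and>
     (\<forall>a\<in>labels \<Theta>. \<forall>i. 1 \<le> i \<and> i + 2 \<le> n \<longrightarrow>
        crossing \<Theta> n x i \<otimes>\<^bsub>gB \<Theta> n\<^esub> crossing \<Theta> n x (i + 1) \<otimes>\<^bsub>gB \<Theta> n\<^esub> crossing \<Theta> n a i =
        crossing \<Theta> n a (i + 1) \<otimes>\<^bsub>gB \<Theta> n\<^esub> crossing \<Theta> n x i \<otimes>\<^bsub>gB \<Theta> n\<^esub> crossing \<Theta> n x (i + 1) \<and>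
        crossing \<Theta> n x (i + 1) \<otimes>\<^bsub>gB \<Theta> n\<^esub> crossing \<Theta> n x i \<otimes>\<^bsub>gB \<Theta> n\<^esub> crossing \<Theta> n a (i + 1) =
        crossing \<Theta> n a i \<otimes>\<^bsub>gB \<Theta> n\<^esub> crossing \<Theta> n x (i + 1) \<otimes>\<^bsub>gB \<Theta> n\<^esub> crossing \<Theta> n x i)"

definition normal_theory :: "('a, 'm) braid_theory_scheme \<Rightarrow> nat \<Rightarrow> 'a \<Rightarrow> bool" where
  "normal_theory \<Theta> n x \<longleftrightarrow> regular \<Theta> \<and> dominant \<Theta> n x"

definition diagram_perm :: "('a \<times> nat) list \<Rightarrow> nat \<Rightarrow> nat" where
  "diagram_perm w = foldr (\<lambda>(a, i) p. transpose i (i + 1) \<circ> p) w id"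

text \<open>All diagrams of a braid have the same permutation (lemma \<open>braid_rel_perm\<close> below).\<close>

definition braid_perm :: "('a \<times> nat) list set \<Rightarrow> nat \<Rightarrow> nat" where
  "braid_perm P = the_elem (diagram_perm ` P)"

definition gPB :: "('a, 'm) braid_theory_scheme \<Rightarrow> nat \<Rightarrow> ('a \<times> nat) list set set" where
  "gPB \<Theta> n = kernel (gB \<Theta> n) (sym_group n) braid_perm"

text \<open>\<open>xword \<Theta> n x i j\<close> is \<open>x\<^sub>i\<^sub>+\<^sub>1 x\<^sub>i\<^sub>+\<^sub>2 \<cdots> x\<^sub>j\<^sub>-\<^sub>1\<close>, which is the identity for \<open>j = i + 1\<close>.\<close>

definition xword :: "('a, 'm) braid_theory_scheme \<Rightarrow> nat \<Rightarrow> 'a \<Rightarrow> nat \<Rightarrow> nat \<Rightarrow> ('a \<times> nat) list set" where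
  "xword \<Theta> n x i j = braid \<Theta> n (map (\<lambda>k. (x, k)) [i + 1..<j])"

text \<open>
  In \<open>lam \<Theta> n x a i j\<close> the label \<open>a\<close> is the left subscript of \<open>\<lambda>\<close>. For \<open>a = x\<close> and \<open>i < j\<close> it is the
  conjugate of \<open>x\<^sub>i\<^sup>2\<close>. The conjugating element is trivial for adjacent strands.
\<close>

definition lam ::
  "('a, 'm) braid_theory_scheme \<Rightarrow> nat \<Rightarrow> 'a \<Rightarrow> 'a \<Rightarrow> nat \<Rightarrow> nat \<Rightarrow> ('a \<times> nat) list set" where
  "lam \<Theta> n x a i j =
     (if i < j
      then inv\<^bsub>gB \<Theta> n\<^esub> (xword \<Theta> n x i j)
             \<otimes>\<^bsub>gB \<Theta> n\<^esub> (crossing \<Theta> n a i \<otimes>\<^bsub>gB \<Theta> n\<^esub> crossing \<Theta> n x i)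
             \<otimes>\<^bsub>gB \<Theta> n\<^esub> xword \<Theta> n x i j
      else inv\<^bsub>gB \<Theta> n\<^esub> (xword \<Theta> n x j i)
             \<otimes>\<^bsub>gB \<Theta> n\<^esub> (crossing \<Theta> n x j \<otimes>\<^bsub>gB \<Theta> n\<^esub> crossing \<Theta> n a j)
             \<otimes>\<^bsub>gB \<Theta> n\<^esub> xword \<Theta> n x j i)"

definition lam_gens :: "('a, 'm) braid_theory_scheme \<Rightarrow> nat \<Rightarrow> 'a \<Rightarrow> ('a \<times> nat) list set set" where
  "lam_gens \<Theta> n x =
     {lam \<Theta> n x a i j | a i j. a \<in> tags \<Theta> - {x} \<and> 1 \<le> i \<and> i < j \<and> j \<le> n} \<union>
     {lam \<Theta> n x a j i | a i j. a \<in> tags \<Theta> - {x} \<and> 1 \<le> i \<and> i < j \<and> j \<le> n} \<union>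
     {lam \<Theta> n x x i j | i j. 1 \<le> i \<and> i < j \<and> j \<le> n}"

lemma diagram_perm_simps [simp]:
  "diagram_perm [] = id"
  "diagram_perm ((a, i) # w) = transpose i (i + 1) \<circ> diagram_perm w"
  by (simp_all add: diagram_perm_def)

lemma diagram_perm_append: "diagram_perm (u @ v) = diagram_perm u \<circ> diagram_perm v"
  by (induction u) (auto simp: comp_assoc)

lemma diagram_perm_permutes: "w \<in> diagrams \<Theta> n \<Longrightarrow> diagram_perm w permutes {1..n}"
proof (induction w)
  case (Cons l w)
  obtain a i where l: "l = (a, i)" by force
  have "i \<in> {1..n}" "i + 1 \<in> {1..n}" "w \<in> diagrams \<Theta> n"
    using Cons.prems by (auto simp: l diagrams_def)
  then have "transpose i (i + 1) \<circ> diagram_perm w permutes {1..n}"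
    using Cons.IH by (intro permutes_compose permutes_swap_id)
  then show ?case by (simp only: l diagram_perm_simps)
next
  case Nil
  show ?case by (simp only: diagram_perm_simps permutes_id)
qed

lemma elementary_moves_perm:
  "(p, q) \<in> elementary_moves \<Theta> n \<Longrightarrow> diagram_perm p = diagram_perm q"
proof (induction rule: elementary_moves.induct)
  case (far a b i j)
  then have "transpose i (i + 1) \<circ> transpose j (j + 1) = transpose j (j + 1) \<circ> transpose i (i + 1)"
    by (auto simp: fun_eq_iff transpose_def)
  then show ?case by simp
next
  case (R3 a b c i)
  have "transpose i (i + 1) \<circ> transpose (i + 1) (i + 2) \<circ> transpose i (i + 1) = transpose i (i + 2)"
    by (rule transpose_comp_triple) auto
  moreover have "transpose (i + 2) (i + 1) \<circ> transpose (i + 1) i \<circ> transpose (i + 2) (i + 1) =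
      transpose (i + 2) i"
    by (rule transpose_comp_triple) auto
  ultimately show ?case by (simp add: transpose_commute comp_assoc)
qed (simp_all del: One_nat_def)

lemma braid_rel_perm: "(u, v) \<in> braid_rel \<Theta> n \<Longrightarrow> diagram_perm u = diagram_perm v"
  by (induction rule: braid_rel.induct) (auto simp: diagram_perm_append dest: elementary_moves_perm)

lemma append_diagrams: "u @ v \<in> diagrams \<Theta> n \<longleftrightarrow> u \<in> diagrams \<Theta> n \<and> v \<in> diagrams \<Theta> n"
  by (simp add: diagrams_def)

context
  fixes \<Theta> :: "('a, 'm) braid_theory_scheme" and n :: nat
  assumes wf: "generalized_braid_theory \<Theta>"
begin

lemma elementary_moves_diagrams:
  "(p, q) \<in> elementary_moves \<Theta> n \<Longrightarrow> p \<in> diagrams \<Theta> n \<and> q \<in> diagrams \<Theta> n"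
  by (induction rule: elementary_moves.induct)
     (use wf in \<open>auto simp: generalized_braid_theory_def diagrams_def labels_def\<close>)

lemma braid_rel_diagrams: "(u, v) \<in> braid_rel \<Theta> n \<Longrightarrow> u \<in> diagrams \<Theta> n \<and> v \<in> diagrams \<Theta> n"
  by (induction rule: braid_rel.induct) (auto simp: append_diagrams dest: elementary_moves_diagrams)

lemma equiv_braid_rel: "equiv (diagrams \<Theta> n) (braid_rel \<Theta> n)"
proof (rule equivI)
  show "braid_rel \<Theta> n \<subseteq> diagrams \<Theta> n \<times> diagrams \<Theta> n"
    by (auto dest: braid_rel_diagrams)
  show "refl_on (diagrams \<Theta> n) (braid_rel \<Theta> n)"
    by (simp add: refl_on_def braid_rel.refl)
  show "Relation.sym (braid_rel \<Theta> n)"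
    by (rule symI) (rule braid_rel.sym)
  show "Relation.trans (braid_rel \<Theta> n)"
    by (rule transI) (rule braid_rel.trans)
qed

lemma braid_rel_append_left:
  "(u, v) \<in> braid_rel \<Theta> n \<Longrightarrow> w \<in> diagrams \<Theta> n \<Longrightarrow> (w @ u, w @ v) \<in> braid_rel \<Theta> n"
proof (induction rule: braid_rel.induct)
  case (move p q u v)
  then show ?case
    using braid_rel.move[of p q \<Theta> n "w @ u" v] by (simp add: append_diagrams)
next
  case (trans u v v')
  then show ?case by (blast intro: braid_rel.trans)
qed (simp_all add: braid_rel.refl braid_rel.sym append_diagrams)

lemma braid_rel_append_right:
  "(u, v) \<in> braid_rel \<Theta> n \<Longrightarrow> w \<in> diagrams \<Theta> n \<Longrightarrow> (u @ w, v @ w) \<in> braid_rel \<Theta> n"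
proof (induction rule: braid_rel.induct)
  case (move p q u v)
  then show ?case
    using braid_rel.move[of p q \<Theta> n u "v @ w"] by (simp add: append_diagrams)
next
  case (trans u v v')
  then show ?case by (blast intro: braid_rel.trans)
qed (simp_all add: braid_rel.refl braid_rel.sym append_diagrams)

lemma braid_eq_iff:
  "u \<in> diagrams \<Theta> n \<Longrightarrow> v \<in> diagrams \<Theta> n \<Longrightarrow>
     braid \<Theta> n u = braid \<Theta> n v \<longleftrightarrow> (u, v) \<in> braid_rel \<Theta> n"
  unfolding braid_def by (rule eq_equiv_class_iff[OF equiv_braid_rel])

lemma carrier_gB: "carrier (gB \<Theta> n) = braid \<Theta> n ` diagrams \<Theta> n"
  by (auto simp: gB_def quotient_def braid_def)

lemma mult_gB:
  assumes "u \<in> diagrams \<Theta> n" and "v \<in> diagrams \<Theta> n"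
  shows "braid \<Theta> n u \<otimes>\<^bsub>gB \<Theta> n\<^esub> braid \<Theta> n v = braid \<Theta> n (u @ v)"
proof -
  have eq: "braid \<Theta> n (u' @ v') = braid \<Theta> n (u @ v)"
    if "u' \<in> braid \<Theta> n u" and "v' \<in> braid \<Theta> n v" for u' v'
  proof -
    have u: "(u, u') \<in> braid_rel \<Theta> n" and v: "(v, v') \<in> braid_rel \<Theta> n"
      using that by (auto simp: braid_def)
    have "(u @ v, u' @ v') \<in> braid_rel \<Theta> n"
      using braid_rel.trans braid_rel_append_right[OF u assms(2)]
        braid_rel_append_left[OF v] braid_rel_diagrams[OF u] by blast
    then show ?thesis
      using braid_eq_iff braid_rel_diagrams by metis
  qed
  have "u \<in> braid \<Theta> n u" "v \<in> braid \<Theta> n v"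
    using assms by (auto simp: braid_def intro: braid_rel.refl)
  then have "(\<Union>u'\<in>braid \<Theta> n u. \<Union>v'\<in>braid \<Theta> n v. braid \<Theta> n (u' @ v')) = braid \<Theta> n (u @ v)"
    using eq by blast
  then show ?thesis by (simp add: gB_def)
qed

lemma one_gB: "\<one>\<^bsub>gB \<Theta> n\<^esub> = braid \<Theta> n []"
  by (simp add: gB_def)

lemma monoid_gB: "monoid (gB \<Theta> n)"
proof -
  have "[] \<in> diagrams \<Theta> n" by (simp add: diagrams_def)
  then show ?thesis
    by unfold_locales (auto simp: carrier_gB mult_gB one_gB append_diagrams)
qed

lemma braid_perm_braid: "w \<in> diagrams \<Theta> n \<Longrightarrow> braid_perm (braid \<Theta> n w) = diagram_perm w"
proof -
  assume "w \<in> diagrams \<Theta> n"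
  then have "diagram_perm ` braid \<Theta> n w = {diagram_perm w}"
    by (auto simp: braid_def image_iff intro!: bexI[of _ w] braid_rel.refl dest: braid_rel_perm)
  then show ?thesis by (simp add: braid_perm_def)
qed

lemma braid_perm_hom: "braid_perm \<in> hom (gB \<Theta> n) (sym_group n)"
  by (auto simp: hom_def carrier_gB mult_gB braid_perm_braid append_diagrams diagram_perm_append
      sym_group_def diagram_perm_permutes simp del: One_nat_def)

lemma braid_perm_crossing:
  "a \<in> labels \<Theta> \<Longrightarrow> i \<in> {1..<n} \<Longrightarrow> braid_perm (crossing \<Theta> n a i) = transpose i (i + 1)"
  by (simp add: crossing_def braid_perm_braid diagrams_def)

lemma group_gB:
  assumes "regular \<Theta>"
  shows "group (gB \<Theta> n)"
proof -
  have nil: "[] \<in> diagrams \<Theta> n" by (simp add: diagrams_def)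
  have letter: "\<exists>b\<in>labels \<Theta>. ([(b, i), (a, i)], []) \<in> braid_rel \<Theta> n"
    if a: "a \<in> labels \<Theta>" and i: "i \<in> {1..<n}" for a i
  proof -
    have "\<exists>b\<in>labels \<Theta>. ([(b, i), (a, i)], []) \<in> elementary_moves \<Theta> n"
      using a i assms wf elementary_moves.R2_left[of _ \<Theta> i n] elementary_moves.R2_right[of _ \<Theta> i n]
      unfolding labels_def regular_def generalized_braid_theory_def by blast
    then show ?thesis
      using braid_rel.move[of _ _ \<Theta> n "[]" "[]"] nil by auto
  qed
  have inv_ex: "\<exists>v\<in>diagrams \<Theta> n. (v @ w, []) \<in> braid_rel \<Theta> n" if "w \<in> diagrams \<Theta> n" for w
    using that
  proof (induction w)
    case Nil
    then show ?case by (auto intro!: bexI[of _ "[]"] braid_rel.refl)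
  next
    case (Cons l w)
    obtain a i where l: "l = (a, i)" by force
    have ai: "a \<in> labels \<Theta>" "i \<in> {1..<n}" and w: "w \<in> diagrams \<Theta> n"
      using Cons.prems l by (auto simp: diagrams_def)
    obtain b where b: "b \<in> labels \<Theta>" "([(b, i), (a, i)], []) \<in> braid_rel \<Theta> n"
      using letter[OF ai] by blast
    obtain v where v: "v \<in> diagrams \<Theta> n" "(v @ w, []) \<in> braid_rel \<Theta> n"
      using Cons.IH w by blast
    have "(v @ [(b, i), (a, i)] @ w, v @ w) \<in> braid_rel \<Theta> n"
      using braid_rel_append_left[OF braid_rel_append_right[OF b(2) w] v(1)] by simp
    then have "((v @ [(b, i)]) @ l # w, []) \<in> braid_rel \<Theta> n"
      using v(2) braid_rel.trans by (fastforce simp: l)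
    moreover have "v @ [(b, i)] \<in> diagrams \<Theta> n"
      using v(1) b(1) ai(2) by (simp add: diagrams_def)
    ultimately show ?case by blast
  qed
  interpret monoid "gB \<Theta> n" by (rule monoid_gB)
  show ?thesis
  proof (rule groupI)
    fix P assume "P \<in> carrier (gB \<Theta> n)"
    then obtain w where w: "w \<in> diagrams \<Theta> n" "P = braid \<Theta> n w"
      by (auto simp: carrier_gB)
    obtain v where v: "v \<in> diagrams \<Theta> n" "(v @ w, []) \<in> braid_rel \<Theta> n"
      using inv_ex w(1) by blast
    then have "braid \<Theta> n v \<otimes>\<^bsub>gB \<Theta> n\<^esub> P = \<one>\<^bsub>gB \<Theta> n\<^esub>"
      using w nil by (simp add: mult_gB one_gB braid_eq_iff append_diagrams)
    then show "\<exists>Q\<in>carrier (gB \<Theta> n). Q \<otimes>\<^bsub>gB \<Theta> n\<^esub> P = \<one>\<^bsub>gB \<Theta> n\<^esub>"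
      using v(1) by (auto simp: carrier_gB)
  qed (auto simp: m_assoc)
qed

end

end

theory Submission
  imports Defs
begin

text \<open>
  The generators \<open>\<lambda>\<close> are permuted by conjugation with the crossings \<open>x\<^sub>k\<close>, up to the choice between
  \<open>x\<^sub>k\<close> and its inverse. As \<open>x\<^sub>k\<^sup>2\<close> is itself a generator, this choice does not matter, so the subgroup
  \<open>H\<close> they generate is normalised by every \<open>x\<^sub>k\<close>, and hence by every \<open>a\<^sub>k = (a\<^sub>k x\<^sub>k) x\<^sub>k\<^sup>-\<^sup>1\<close>.
  Modulo \<open>H\<close> all crossings \<open>a\<^sub>k\<close> agree with \<open>x\<^sub>k\<close>, and the \<open>x\<^sub>k\<close> become involutions that satisfy the
  braid relations. By the Coxeter presentation of the symmetric group, a braid with trivial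
  permutation is therefore trivial modulo \<open>H\<close>.
\<close>

section \<open>The Coxeter presentation of the symmetric group\<close>

text \<open>Artin's braid relations for a family that need not generate \<open>G\<close>. Stated
  over a monoid, so that one word calculus serves braid groups, symmetric groups, quotients and
  direct products.\<close>

locale braid_family = monoid G for G (structure) +
  fixes s :: "nat \<Rightarrow> 'a" and n :: nat
  assumes s_closed [simp, intro]: "i \<in> {1..<n} \<Longrightarrow> s i \<in> carrier G"
    and far_comm: "i \<in> {1..<n} \<Longrightarrow> j \<in> {1..<n} \<Longrightarrow> i + 1 < j \<Longrightarrow> s i \<otimes> s j = s j \<otimes> s i"
    and braid_eq: "1 \<le> i \<Longrightarrow> i + 1 < n \<Longrightarrow>
      s i \<otimes> s (i + 1) \<otimes> s i = s (i + 1) \<otimes> s i \<otimes> s (i + 1)"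
begin

definition word_prod :: "nat list \<Rightarrow> 'a" where
  "word_prod w = foldr (\<lambda>i g. s i \<otimes> g) w \<one>"

lemma word_prod_simps [simp]:
  "word_prod [] = \<one>"
  "word_prod (i # w) = s i \<otimes> word_prod w"
  by (simp_all add: word_prod_def)

lemma word_prod_closed [simp, intro]: "w \<in> lists {1..<n} \<Longrightarrow> word_prod w \<in> carrier G"
  by (induction w) auto

lemma word_prod_append [simp]:
  "u \<in> lists {1..<n} \<Longrightarrow> v \<in> lists {1..<n} \<Longrightarrow>
     word_prod (u @ v) = word_prod u \<otimes> word_prod v"
  by (induction u) (simp_all add: m_assoc)

lemma word_prod_commute:
  assumes "g \<in> carrier G" and "w \<in> lists {1..<n}" and "\<And>i. i \<in> set w \<Longrightarrow> g \<otimes> s i = s i \<otimes> g"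
  shows "g \<otimes> word_prod w = word_prod w \<otimes> g"
  using assms(2,3)
proof (induction w)
  case (Cons i w)
  then have *: "s i \<in> carrier G" "word_prod w \<in> carrier G" "g \<otimes> s i = s i \<otimes> g"
    "g \<otimes> word_prod w = word_prod w \<otimes> g"
    by auto
  have "g \<otimes> word_prod (i # w) = (g \<otimes> s i) \<otimes> word_prod w"
    using *(1,2) assms(1) by (simp add: m_assoc)
  also have "\<dots> = s i \<otimes> (g \<otimes> word_prod w)"
    unfolding *(3) using *(1,2) assms(1) by (simp add: m_assoc)
  also have "\<dots> = word_prod (i # w) \<otimes> g"
    unfolding *(4) using *(1,2) assms(1) by (simp add: m_assoc)
  finally show ?case .
qed (use assms(1) in auto)

lemma s_word_prod_commute:
  assumes "k \<in> {1..<n}" and "w \<in> lists {1..<n}" and "\<And>i. i \<in> set w \<Longrightarrow> i + 1 < k \<or> k + 1 < i"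
  shows "s k \<otimes> word_prod w = word_prod w \<otimes> s k"
proof (rule word_prod_commute)
  show "s k \<otimes> s i = s i \<otimes> s k" if "i \<in> set w" for i
  proof -
    have "i \<in> {1..<n}" using that assms(2) by auto
    then show ?thesis
      using assms(3)[OF that] far_comm[of i k] far_comm[of k i] assms(1) by auto
  qed
qed (use assms in auto)

text \<open>\<open>s k\<close> passes \<open>v\<close>, the braid relation turns \<open>s k\<close>,
  \<open>s l\<close>, \<open>s k\<close> into \<open>s l\<close>, \<open>s k\<close>,
  \<open>s l\<close>, and the freed \<open>s l\<close> passes \<open>u\<close>. Allowing either
  order of \<open>k\<close> and \<open>l\<close> covers ascending and descending runs alike.\<close>

lemma word_prod_shift_letter:
  assumes w: "u @ [k, l] @ v \<in> lists {1..<n}" and kl: "l = k + 1 \<or> k = l + 1"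
    and u: "\<And>i. i \<in> set u \<Longrightarrow> i + 1 < l \<or> l + 1 < i"
    and v: "\<And>i. i \<in> set v \<Longrightarrow> i + 1 < k \<or> k + 1 < i"
  shows "word_prod (u @ [k, l] @ v) \<otimes> s k = s l \<otimes> word_prod (u @ [k, l] @ v)"
proof -
  have carr: "k \<in> {1..<n}" "l \<in> {1..<n}" "u \<in> lists {1..<n}" "v \<in> lists {1..<n}"
    using w by auto
  then have G: "s k \<in> carrier G" "s l \<in> carrier G" "word_prod u \<in> carrier G" "word_prod v \<in> carrier G"
    by blast+
  have br: "s k \<otimes> (s l \<otimes> s k) = s l \<otimes> (s k \<otimes> s l)"
    using kl braid_eq[of k] braid_eq[of l] carr G by (auto simp: m_assoc)
  have "word_prod (u @ [k, l] @ v) \<otimes> s k = word_prod u \<otimes> (s k \<otimes> (s l \<otimes> (word_prod v \<otimes> s k)))"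
    using carr G by (simp add: m_assoc)
  also have "\<dots> = word_prod u \<otimes> ((s k \<otimes> (s l \<otimes> s k)) \<otimes> word_prod v)"
    using G by (simp add: m_assoc flip: s_word_prod_commute[OF carr(1,4) v])
  also have "\<dots> = (word_prod u \<otimes> s l) \<otimes> (s k \<otimes> (s l \<otimes> word_prod v))"
    using G by (simp add: m_assoc br)
  also have "\<dots> = s l \<otimes> word_prod (u @ [k, l] @ v)"
    using G carr by (simp add: m_assoc flip: s_word_prod_commute[OF carr(2,3) u])
  finally show ?thesis .
qed

lemma word_prod_ascending_shift:
  assumes "1 \<le> i" and "i \<le> k" and "k + 1 < j" and "j \<le> n"
  shows "word_prod [i..<j] \<otimes> s k = s (k + 1) \<otimes> word_prod [i..<j]"
proof -
  have "[i..<j] = [i..<k] @ [k..<j]"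
    using assms upt_add_eq_append[of i k "j - k"] by simp
  also have "[k..<j] = [k, k + 1] @ [k + 2..<j]"
    using assms by (simp add: upt_conv_Cons)
  \<comment> \<open>Letters before the pair are at most \<open>k - 1\<close>, hence far from
    \<open>k + 1\<close>; those after it are at least \<open>k + 2\<close>, hence far from
    \<open>k\<close>.\<close>
  finally have eq: "[i..<j] = [i..<k] @ [k, k + 1] @ [k + 2..<j]" .
  have "[i..<j] \<in> lists {1..<n}"
    using assms by auto
  then show ?thesis
    unfolding eq by (intro word_prod_shift_letter) auto
qed

lemma word_prod_descending_shift:
  assumes "1 \<le> j" and "j < k" and "k < m" and "m \<le> n"
  shows "word_prod (rev [j..<m]) \<otimes> s k = s (k - 1) \<otimes> word_prod (rev [j..<m])"
proof -
  have "[j..<m] = [j..<k - 1] @ [k - 1..<m]"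
    using assms upt_add_eq_append[of j "k - 1" "m - (k - 1)"] by simp
  also have "[k - 1..<m] = [k - 1, k] @ [k + 1..<m]"
    using assms by (simp add: upt_conv_Cons)
  finally have eq: "rev [j..<m] = rev [k + 1..<m] @ [k, k - 1] @ rev [j..<k - 1]"
    by simp
  have "rev [j..<m] \<in> lists {1..<n}"
    using assms by auto
  then show ?thesis
    unfolding eq by (intro word_prod_shift_letter) (use assms in auto)
qed

end

section \<open>Normal form of words under the Coxeter relations\<close>

locale coxeter_family = braid_family +
  assumes involution: "i \<in> {1..<n} \<Longrightarrow> s i \<otimes> s i = \<one>"
begin

text \<open>
  Appending \<open>s\<^sub>k\<close> to a run \<open>s\<^sub>m \<cdots> s\<^sub>j\<close> either moves a letter to the left of the run, or lengthens it, or
  shortens it by \<open>s\<^sub>j\<^sup>2 = 1\<close>; the run sends \<open>j\<close> to \<open>m + 1\<close>, so the permutation determines \<open>j\<close>.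
\<close>

lemma normal_form:
  assumes "m < n" and "w \<in> lists {1..m}"
  shows "\<exists>w'\<in>lists {1..<m}. \<exists>j\<in>{1..m + 1}. word_prod w = word_prod w' \<otimes> word_prod (rev [j..<m + 1])"
  using assms(2)
proof (induction w rule: rev_induct)
  case Nil
  \<comment> \<open>The empty run is \<open>j = m + 1\<close>.\<close>
  show ?case
    by (intro bexI[of _ "[]"] bexI[of _ "m + 1"]) auto
next
  case (snoc k w)
  then have "w \<in> lists {1..m}" by simp
  from snoc.IH[OF this] obtain w' j where w': "w' \<in> lists {1..<m}" and j: "j \<in> {1..m + 1}"
    and eq: "word_prod w = word_prod w' \<otimes> word_prod (rev [j..<m + 1])"
    by (elim bexE)
  have k: "k \<in> {1..m}" "k \<in> {1..<n}" and w: "w \<in> lists {1..<n}"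
    using snoc.prems assms(1) by auto
  have w'n: "w' \<in> lists {1..<n}"
    using w' assms(1) by auto
  have run: "rev [i..<m + 1] \<in> lists {1..<n}" if "i \<ge> 1" for i
    using that assms(1) by auto
  have run_snoc: "word_prod (rev [i..<m + 1]) = word_prod (rev [i + 1..<m + 1]) \<otimes> s i"
    if "i \<in> {1..m}" for i
  proof -
    have "rev [i..<m + 1] = rev [i + 1..<m + 1] @ [i]"
      using that by (simp add: upt_conv_Cons)
    then have "word_prod (rev [i..<m + 1]) = word_prod (rev [i + 1..<m + 1]) \<otimes> word_prod [i]"
      using that assms(1) run[of "i + 1"] by (simp only:) (intro word_prod_append; auto)
    then show ?thesis
      using that assms(1) by simp
  qed
  have G: "s k \<in> carrier G" "word_prod w' \<in> carrier G" "word_prod (rev [j..<m + 1]) \<in> carrier G"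
    using k w'n run j by auto
  have "word_prod (w @ [k]) = word_prod w \<otimes> word_prod [k]"
    using k w by (intro word_prod_append) auto
  then have step: "word_prod (w @ [k]) = word_prod w' \<otimes> (word_prod (rev [j..<m + 1]) \<otimes> s k)"
    using G by (simp add: eq m_assoc)
  \<comment> \<open>Common end of the first and last cases below: crossing the run turns
    \<open>s k\<close> into \<open>s l\<close> with \<open>l < m\<close>, and \<open>w'\<close>
    absorbs \<open>l\<close>.\<close>
  have shift: ?case if "l \<in> {1..<m}" and
    "word_prod (rev [j..<m + 1]) \<otimes> s k = s l \<otimes> word_prod (rev [j..<m + 1])" for l
  proof -
    have l: "l \<in> {1..<n}" "[l] \<in> lists {1..<n}"
      using that assms(1) by auto
    then have "s l \<in> carrier G" by blast
    then have "word_prod (w @ [k]) = word_prod (w' @ [l]) \<otimes> word_prod (rev [j..<m + 1])"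
      unfolding step that(2) using G w'n l by (simp add: m_assoc)
    then show ?thesis
      using w' that(1) j by (intro bexI[of _ "w' @ [l]"] bexI[of _ j]) auto
  qed
  \<comment> \<open>Position of \<open>k\<close> relative to \<open>j\<close>, the lowest letter of
    a nonempty run: far below it, extending the run, cancelling \<open>j\<close>, or inside the run
    above it.\<close>
  consider "k + 1 < j" | "k + 1 = j" | "k = j" | "j < k" by linarith
  then show ?case
  proof cases
    case 1
    then have "s k \<otimes> word_prod (rev [j..<m + 1]) = word_prod (rev [j..<m + 1]) \<otimes> s k"
      using k run j by (intro s_word_prod_commute) auto
    then show ?thesis
      using 1 k j by (intro shift[of k]) auto
  next
    case 2
    then have "word_prod (w @ [k]) = word_prod w' \<otimes> word_prod (rev [k..<m + 1])"
      using step run_snoc[OF k(1)] by simp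
    then show ?thesis
      using w' k by (intro bexI[of _ w'] bexI[of _ k]) auto
  next
    case 3
    have "word_prod (rev [j + 1..<m + 1]) \<in> carrier G"
      by (intro word_prod_closed run) simp
    then have "word_prod (rev [j..<m + 1]) \<otimes> s k = word_prod (rev [j + 1..<m + 1])"
      unfolding 3[symmetric] run_snoc[OF k(1)] using G(1) involution[OF k(2)] by (simp add: m_assoc 3 del: upt_Suc)
    then have "word_prod (w @ [k]) = word_prod w' \<otimes> word_prod (rev [j + 1..<m + 1])"
      using step by simp
    then show ?thesis
      using w' k 3 by (intro bexI[of _ w'] bexI[of _ "j + 1"]) auto
  next
    case 4
    have "word_prod (rev [j..<m + 1]) \<otimes> s k = s (k - 1) \<otimes> word_prod (rev [j..<m + 1])"
      using 4 k j assms(1) by (intro word_prod_descending_shift) auto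
    then show ?thesis
      using 4 k j by (intro shift[of "k - 1"]) auto
  qed
qed

end

text \<open>The shadow of \<open>diagram_perm\<close> on positions alone, with labels forgotten;
  equally the value of the word at the adjacent transpositions of the symmetric group.\<close>

definition word_perm :: "nat list \<Rightarrow> nat \<Rightarrow> nat" where
  "word_perm w = foldr (\<lambda>i p. transpose i (i + 1) \<circ> p) w id"

lemma word_perm_simps [simp]:
  "word_perm [] = id"
  "word_perm (i # w) = transpose i (i + 1) \<circ> word_perm w"
  by (simp_all add: word_perm_def)

text \<open>The letter \<open>i\<close> moves only \<open>i\<close> and \<open>i + 1\<close>,
  neither of which exceeds \<open>m\<close> when \<open>i < m\<close>.\<close>

lemma word_perm_fixes: "(\<And>i. i \<in> set w \<Longrightarrow> i < m) \<Longrightarrow> m < k \<Longrightarrow> word_perm w k = k"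
  by (induction w) (force simp: transpose_def)+

text \<open>The rightmost letter \<open>j\<close> acts first, so the run carries \<open>j\<close>
  upwards one position at a time.\<close>

lemma word_perm_descending: "j \<le> m \<Longrightarrow> word_perm (rev [j..<m]) j = m"
proof (induction m rule: dec_induct)
  case (step m)
  then show ?case by simp
qed simp

lemma sym_group_coxeter_family:
  "coxeter_family (sym_group n) (\<lambda>i. transpose i (i + 1)) n"
proof -
  interpret S: group "sym_group n" by (rule sym_group_is_group)
  show ?thesis
  proof unfold_locales
    fix i j assume "i \<in> {1..<n}" "j \<in> {1..<n}" "i + 1 < j"
    then show "transpose i (i + 1) \<otimes>\<^bsub>sym_group n\<^esub> transpose j (j + 1) =
        transpose j (j + 1) \<otimes>\<^bsub>sym_group n\<^esub> transpose i (i + 1)"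
      by (auto simp: sym_group_mult fun_eq_iff transpose_def)
  next
    fix i :: nat
    show "transpose i (i + 1) \<otimes>\<^bsub>sym_group n\<^esub> transpose (i + 1) (i + 1 + 1)
          \<otimes>\<^bsub>sym_group n\<^esub> transpose i (i + 1) =
        transpose (i + 1) (i + 1 + 1) \<otimes>\<^bsub>sym_group n\<^esub> transpose i (i + 1)
          \<otimes>\<^bsub>sym_group n\<^esub> transpose (i + 1) (i + 1 + 1)"
      by (auto simp: sym_group_mult fun_eq_iff transpose_def)
  qed (auto simp: sym_group_carrier sym_group_mult sym_group_one intro: permutes_swap_id)
qed

text \<open>
  The normal form is applied in \<open>G \<times>\<times> sym_group n\<close>, so that one and the same factorisation
  describes both the product of the word in \<open>G\<close> and its permutation.
\<close>

theorem (in coxeter_family) word_prod_eq_one: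
  assumes "w \<in> lists {1..<n}" and "word_perm w = id"
  shows "word_prod w = \<one>"
proof -
  let ?K = "G \<times>\<times> sym_group n"
  interpret S: coxeter_family "sym_group n" "\<lambda>i. transpose i (i + 1)" n
    by (rule sym_group_coxeter_family)
  interpret K: monoid ?K
    by (rule DirProd_monoid) unfold_locales
  interpret K: coxeter_family ?K "\<lambda>i. (s i, transpose i (i + 1))" n
  proof unfold_locales
    show "(s i, transpose i (i + 1)) \<otimes>\<^bsub>?K\<^esub> (s j, transpose j (j + 1)) =
        (s j, transpose j (j + 1)) \<otimes>\<^bsub>?K\<^esub> (s i, transpose i (i + 1))"
      if "i \<in> {1..<n}" "j \<in> {1..<n}" "i + 1 < j" for i j
      unfolding mult_DirProd far_comm[OF that] S.far_comm[OF that] ..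
  qed (simp_all only: mult_DirProd carrier_DirProd one_DirProd mem_Times_iff fst_conv snd_conv
        s_closed S.s_closed braid_eq S.braid_eq involution S.involution simp_thms)
  have K: "K.word_prod w = (word_prod w, word_perm w)" for w
    by (induction w) (simp_all only: K.word_prod_simps word_prod_simps word_perm_simps
        one_DirProd mult_DirProd sym_group_one sym_group_mult)
  \<comment> \<open>Induction on a strict bound \<open>m\<close> for the letters: the factor
    \<open>w'\<close> of the normal form obeys the next smaller bound.\<close>
  have "word_prod w = \<one>" if "m \<le> n" and "w \<in> lists {1..<m}" and "word_perm w = id" for w m
    using that
  proof (induction m arbitrary: w)
    case (Suc m)
    have "m < n" "w \<in> lists {1..m}" using Suc.prems by auto
    then obtain w' j where w': "w' \<in> lists {1..<m}" and j: "j \<in> {1..m + 1}"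
      and "K.word_prod w = K.word_prod w' \<otimes>\<^bsub>?K\<^esub> K.word_prod (rev [j..<m + 1])"
      using K.normal_form by blast
    then have eq: "word_prod w = word_prod w' \<otimes> word_prod (rev [j..<m + 1])"
      "word_perm w = word_perm w' \<circ> word_perm (rev [j..<m + 1])"
      unfolding K by (simp_all add: sym_group_mult del: upt_Suc)
    \<comment> \<open>Evaluate at \<open>j\<close>: the run carries \<open>j\<close> to
      \<open>m + 1\<close>, which \<open>w'\<close> fixes as its letters are below \<open>m\<close>.
      A trivial permutation thus forces the empty run.\<close>
    have "j = word_perm w' (m + 1)"
      using fun_cong[OF eq(2), of j] Suc.prems(3) word_perm_descending[of j "m + 1"] j by simp
    also have "\<dots> = m + 1"
      using w' by (intro word_perm_fixes[of _ m]) auto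
    finally have j: "rev [j..<m + 1] = []" by simp
    have "word_prod w = word_prod w' \<otimes> \<one>" "word_perm w' = id"
      using eq Suc.prems(3) by (simp_all only: j word_prod_simps word_perm_simps comp_id)
    moreover have "word_prod w' \<in> carrier G"
      using w' \<open>m < n\<close> by (intro word_prod_closed) auto
    ultimately show ?case
      using Suc.IH[OF _ w'] \<open>m < n\<close> by simp
  qed auto
  then show ?thesis using assms by blast
qed

section \<open>Conjugating bands by braid generators\<close>

locale braid_family_group = braid_family + group G
begin

text \<open>
  The last clause is the dominance relation: \<open>s\<^sub>i\<^sub>+\<^sub>1 s\<^sub>i\<close> conjugates \<open>u\<^sub>i\<^sub>+\<^sub>1\<close> into \<open>u\<^sub>i\<close>.
\<close>

definition slides :: "(nat \<Rightarrow> 'a) \<Rightarrow> bool" where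
  "slides u \<longleftrightarrow>
     (\<forall>i\<in>{1..<n}. u i \<in> carrier G) \<and>
     (\<forall>i\<in>{1..<n}. \<forall>k\<in>{1..<n}. i + 1 < k \<or> k + 1 < i \<longrightarrow> s k \<otimes> u i = u i \<otimes> s k) \<and>
     (\<forall>i. 1 \<le> i \<and> i + 1 < n \<longrightarrow> s (i + 1) \<otimes> s i \<otimes> u (i + 1) = u i \<otimes> s (i + 1) \<otimes> s i)"

text \<open>The abstract form of \<open>lam\<close>: an arbitrary family \<open>u\<close> replaces
  the double crossings, so that all labels and both orders are handled at once.\<close>

definition band :: "(nat \<Rightarrow> 'a) \<Rightarrow> nat \<Rightarrow> nat \<Rightarrow> 'a" where
  "band u i j = inv (word_prod [i + 1..<j]) \<otimes> u i \<otimes> word_prod [i + 1..<j]"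

lemma run_closed: "j \<le> n \<Longrightarrow> word_prod [i + 1..<j] \<in> carrier G"
  by (intro word_prod_closed) auto

context
  fixes u :: "nat \<Rightarrow> 'a"
  assumes slides: "slides u"
begin

lemma slides_closed: "i \<in> {1..<n} \<Longrightarrow> u i \<in> carrier G"
  using slides by (simp add: slides_def)

lemma slides_far:
  "i \<in> {1..<n} \<Longrightarrow> k \<in> {1..<n} \<Longrightarrow> i + 1 < k \<or> k + 1 < i \<Longrightarrow> s k \<otimes> u i = u i \<otimes> s k"
  using slides unfolding slides_def by blast

lemma slides_shift:
  "1 \<le> i \<Longrightarrow> i + 1 < n \<Longrightarrow> s (i + 1) \<otimes> (s i \<otimes> u (i + 1)) = u i \<otimes> (s (i + 1) \<otimes> s i)"
  using slides by (simp add: slides_def slides_closed flip: m_assoc)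

end

text \<open>Conjugation respects products; this carries the property from single crossings to the
  double crossings \<open>a_i x_i\<close> and \<open>x_i a_i\<close>.\<close>

lemma slides_mult:
  assumes u: "slides u" and v: "slides v"
  shows "slides (\<lambda>i. u i \<otimes> v i)"
  unfolding slides_def
proof (intro conjI ballI allI impI)
  note closed = slides_closed[OF u] slides_closed[OF v]
  show "u i \<otimes> v i \<in> carrier G" if "i \<in> {1..<n}" for i
    using closed[OF that] by simp
  show "s k \<otimes> (u i \<otimes> v i) = u i \<otimes> v i \<otimes> s k"
    if i: "i \<in> {1..<n}" and k: "k \<in> {1..<n}" and ik: "i + 1 < k \<or> k + 1 < i" for i k
  proof -
    have "s k \<otimes> u i = u i \<otimes> s k" "s k \<otimes> v i = v i \<otimes> s k"
      using slides_far[OF u i k ik] slides_far[OF v i k ik] by simp_all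
    then show ?thesis
      using closed[OF i] s_closed[OF k] by (metis m_assoc)
  qed
  show "s (i + 1) \<otimes> s i \<otimes> (u (i + 1) \<otimes> v (i + 1)) = u i \<otimes> v i \<otimes> s (i + 1) \<otimes> s i"
    if i: "1 \<le> i \<and> i + 1 < n" for i
  proof -
    have in_range: "i \<in> {1..<n}" "i + 1 \<in> {1..<n}" using i by auto
    then have G: "s i \<in> carrier G" "s (i + 1) \<in> carrier G" "u i \<in> carrier G" "v i \<in> carrier G"
      "u (i + 1) \<in> carrier G" "v (i + 1) \<in> carrier G"
      using closed s_closed by blast+
    have "s (i + 1) \<otimes> s i \<otimes> (u (i + 1) \<otimes> v (i + 1)) = s (i + 1) \<otimes> (s i \<otimes> u (i + 1)) \<otimes> v (i + 1)"
      using G by (simp add: m_assoc)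
    also have "\<dots> = u i \<otimes> (s (i + 1) \<otimes> (s i \<otimes> v (i + 1)))"
      using slides_shift[OF u] i G by (simp add: m_assoc)
    also have "\<dots> = u i \<otimes> v i \<otimes> s (i + 1) \<otimes> s i"
      using slides_shift[OF v] i G by (simp add: m_assoc)
    finally show ?thesis .
  qed
qed

context
  fixes u :: "nat \<Rightarrow> 'a"
  assumes slides: "slides u"
begin

lemma band_closed: "1 \<le> i \<Longrightarrow> i < j \<Longrightarrow> j \<le> n \<Longrightarrow> band u i j \<in> carrier G"
  using run_closed slides_closed[OF slides] by (simp add: band_def)

lemma run_band:
  "1 \<le> i \<Longrightarrow> i < j \<Longrightarrow> j \<le> n \<Longrightarrow>
     word_prod [i + 1..<j] \<otimes> band u i j = u i \<otimes> word_prod [i + 1..<j]"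
  using run_closed[of j i] slides_closed[OF slides] by (simp add: band_def flip: m_assoc)

lemma band_adjacent: "i \<in> {1..<n} \<Longrightarrow> band u i (i + 1) = u i"
  using slides_closed[OF slides] by (simp add: band_def)

text \<open>\<open>s j\<close> is exactly the letter by which the conjugating word of
  \<open>band u i (j + 1)\<close> extends that of \<open>band u i j\<close>.\<close>

lemma band_right:
  assumes "1 \<le> i" and "i < j" and "j < n"
  shows "band u i j \<otimes> s j = s j \<otimes> band u i (j + 1)"
proof -
  let ?W = "word_prod [i + 1..<j]"
  have G: "?W \<in> carrier G" "s j \<in> carrier G" "u i \<in> carrier G"
    "band u i j \<in> carrier G" "band u i (j + 1) \<in> carrier G"
    using assms by (auto intro!: run_closed slides_closed[OF slides] band_closed simp del: One_nat_def)
  have "word_prod ([i + 1..<j] @ [j]) = ?W \<otimes> word_prod [j]"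
    using assms by (intro word_prod_append) auto
  then have W: "word_prod [i + 1..<j + 1] = ?W \<otimes> s j"
    using assms G by simp
  \<comment> \<open>Both sides are compared after multiplication by the conjugating word
    \<open>?W\<close>, which is cancelled at the end.\<close>
  have "?W \<otimes> (band u i j \<otimes> s j) = u i \<otimes> (?W \<otimes> s j)"
    using run_band[of i j] assms G by (simp flip: m_assoc)
  also have "\<dots> = ?W \<otimes> (s j \<otimes> band u i (j + 1))"
    using run_band[of i "j + 1"] assms G unfolding W by (simp add: m_assoc)
  finally show ?thesis
    using G by simp
qed

text \<open>The conjugating words differ in their first letter \<open>s (i + 1)\<close>. As
  \<open>s i\<close> commutes with the remaining letters, the claim reduces to the sliding relation
  between \<open>u (i + 1)\<close> and \<open>u i\<close>.\<close>

lemma band_left: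
  assumes "1 \<le> i" and "i + 1 < j" and "j \<le> n"
  shows "band u i j \<otimes> s i = s i \<otimes> band u (i + 1) j"
proof -
  \<comment> \<open>\<open>W\<close> conjugates \<open>u (i + 1)\<close> into \<open>B'\<close>, and
    \<open>t \<otimes> W\<close> conjugates \<open>u i\<close> into \<open>B\<close>.\<close>
  define W where "W = word_prod [i + 2..<j]"
  define t where "t = s (i + 1)"
  define v where "v = u (i + 1)"
  define B where "B = band u i j"
  define B' where "B' = band u (i + 1) j"
  have G: "W \<in> carrier G" "s i \<in> carrier G" "t \<in> carrier G" "u i \<in> carrier G" "v \<in> carrier G"
    "B \<in> carrier G" "B' \<in> carrier G"
    using assms run_closed[of j "i + 1"]
    by (auto simp: W_def t_def v_def B_def B'_def intro!: slides_closed[OF slides] band_closed)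
  have W: "word_prod [i + 1..<j] = t \<otimes> W"
    using assms by (simp add: upt_conv_Cons W_def t_def)
  have B: "t \<otimes> (W \<otimes> B) = u i \<otimes> (t \<otimes> W)"
    using run_band[of i j] assms G unfolding W B_def[symmetric] by (simp add: m_assoc)
  have B': "W \<otimes> B' = v \<otimes> W"
    using run_band[of "i + 1" j] assms by (simp add: W_def v_def B'_def)
  have comm: "W \<otimes> s i = s i \<otimes> W"
    unfolding W_def using assms by (intro s_word_prod_commute[symmetric]) auto
  have shift: "t \<otimes> (s i \<otimes> v) = u i \<otimes> (t \<otimes> s i)"
    unfolding t_def v_def using assms by (intro slides_shift[OF slides]) auto
  have "(t \<otimes> W) \<otimes> (B \<otimes> s i) = (t \<otimes> (W \<otimes> B)) \<otimes> s i"
    using G by (simp add: m_assoc)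
  also have "\<dots> = (u i \<otimes> (t \<otimes> s i)) \<otimes> W"
    unfolding B using G by (simp add: m_assoc comm)
  also have "\<dots> = t \<otimes> (s i \<otimes> (W \<otimes> B'))"
    unfolding shift[symmetric] B' using G by (simp add: m_assoc)
  also have "\<dots> = t \<otimes> ((W \<otimes> s i) \<otimes> B')"
    unfolding comm using G by (simp add: m_assoc)
  also have "\<dots> = (t \<otimes> W) \<otimes> (s i \<otimes> B')"
    using G by (simp add: m_assoc)
  finally show ?thesis
    unfolding B_def[symmetric] B'_def[symmetric]
    by (rule Units_l_cancel[THEN iffD1, rotated 3]) (use G in auto)
qed

text \<open>Passing the conjugating word turns \<open>s k\<close> into \<open>s l\<close>, and
  \<open>s l\<close> commutes with \<open>u i\<close>. It is applied with \<open>l = k\<close> when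
  \<open>k\<close> is far from the whole band and with \<open>l = k + 1\<close> when the crossing
  lies strictly inside.\<close>

lemma band_commute:
  assumes "1 \<le> i" and "i < j" and "j \<le> n" and "k \<in> {1..<n}" and "l \<in> {1..<n}"
    and "s l \<otimes> u i = u i \<otimes> s l"
    and W: "word_prod [i + 1..<j] \<otimes> s k = s l \<otimes> word_prod [i + 1..<j]"
  shows "band u i j \<otimes> s k = s k \<otimes> band u i j"
proof -
  let ?W = "word_prod [i + 1..<j]"
  have G: "?W \<in> carrier G" "s k \<in> carrier G" "s l \<in> carrier G" "u i \<in> carrier G"
    "band u i j \<in> carrier G"
    using assms(1-5) by (auto intro!: run_closed slides_closed[OF slides] band_closed simp del: One_nat_def)
  have "?W \<otimes> (band u i j \<otimes> s k) = u i \<otimes> (?W \<otimes> s k)"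
    using run_band[of i j] assms(1-3) G by (simp flip: m_assoc)
  also have "\<dots> = s l \<otimes> (u i \<otimes> ?W)"
    unfolding W using G assms(6) by (simp flip: m_assoc)
  also have "\<dots> = s l \<otimes> (?W \<otimes> band u i j)"
    using run_band[of i j] assms(1-3) by simp
  also have "\<dots> = ?W \<otimes> (s k \<otimes> band u i j)"
    using G W by (metis m_assoc)
  finally show ?thesis
    using G by simp
qed

text \<open>A crossing leaves a band unchanged or moves one of its ends by one position: to the
  right under conjugation by \<open>inv (s k)\<close>, to the left under conjugation by
  \<open>s k\<close>. Hence the disjunction. The excluded case, an adjacent band met by its own
  crossing, depends on \<open>u\<close> itself.\<close>

lemma band_conjugation:
  assumes "1 \<le> i" and "i < j" and "j \<le> n" and "k \<in> {1..<n}" and "\<not> (k = i \<and> j = i + 1)"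
  shows "\<exists>i' j'. 1 \<le> i' \<and> i' < j' \<and> j' \<le> n \<and>
    (band u i j \<otimes> s k = s k \<otimes> band u i' j' \<or> s k \<otimes> band u i j = band u i' j' \<otimes> s k)"
proof -
  consider "k + 1 < i \<or> j < k" | "k + 1 = i" | "k = i" "i + 1 < j" | "i < k" "k + 1 < j"
    | "i < k" "k + 1 = j" | "k = j"
    using assms by linarith
  then show ?thesis
  proof cases
    case 1
    have "band u i j \<otimes> s k = s k \<otimes> band u i j"
    proof (rule band_commute)
      show "s k \<otimes> u i = u i \<otimes> s k"
        using assms 1 by (intro slides_far[OF slides]) auto
      show "word_prod [i + 1..<j] \<otimes> s k = s k \<otimes> word_prod [i + 1..<j]"
        using assms 1 by (intro s_word_prod_commute[symmetric]) auto
    qed (use assms in auto)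
    then show ?thesis using assms by blast
  next
    case 2
    then show ?thesis
      using band_left[of k j] assms by (intro exI[of _ k] exI[of _ j]) auto
  next
    case 3
    then show ?thesis
      using band_left[of i j] assms by (intro exI[of _ "i + 1"] exI[of _ j]) auto
  next
    case 4
    have "band u i j \<otimes> s k = s k \<otimes> band u i j"
    proof (rule band_commute)
      show "s (k + 1) \<otimes> u i = u i \<otimes> s (k + 1)"
        using assms 4 by (intro slides_far[OF slides]) auto
      show "word_prod [i + 1..<j] \<otimes> s k = s (k + 1) \<otimes> word_prod [i + 1..<j]"
        using assms 4 by (intro word_prod_ascending_shift) auto
    qed (use assms 4 in auto)
    then show ?thesis using assms by blast
  next
    case 5
    then show ?thesis
      using band_right[of i k] assms by (intro exI[of _ i] exI[of _ k]) auto
  next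
    case 6
    then show ?thesis
      using band_right[of i j] assms by (intro exI[of _ i] exI[of _ "j + 1"]) auto
  qed
qed

end

end

text \<open>
  Since \<open>x\<^sup>2\<close> lies in the subgroup, each generator needs to be conjugated in one direction only.
\<close>

lemma (in group) generate_conjugation_closed:
  assumes S: "S \<subseteq> carrier G" and x: "x \<in> carrier G" and sq: "x \<otimes> x \<in> generate G S"
    and conj: "\<And>g. g \<in> S \<Longrightarrow> \<exists>g'\<in>generate G S. g \<otimes> x = x \<otimes> g' \<or> x \<otimes> g = g' \<otimes> x"
    and h: "h \<in> generate G S"
  shows "x \<otimes> h \<otimes> inv x \<in> generate G S" and "inv x \<otimes> h \<otimes> x \<in> generate G S"
proof -
  let ?H = "generate G S"
  interpret H: subgroup ?H G
    by (rule generate_is_subgroup[OF S])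
  have cancel: "inv x \<otimes> (x \<otimes> y) = y" "x \<otimes> (inv x \<otimes> y) = y" if "y \<in> carrier G" for y
    using x that by (simp_all flip: m_assoc)
  show conj': "x \<otimes> h \<otimes> inv x \<in> ?H"
    using h
  proof (induction rule: generate.induct)
    case one
    show ?case using x by simp
  next
    have *: "x \<otimes> g \<otimes> inv x \<in> ?H" if "g \<in> S" for g
    proof -
      obtain g' where g': "g' \<in> ?H" and disj: "g \<otimes> x = x \<otimes> g' \<or> x \<otimes> g = g' \<otimes> x"
        using conj[OF \<open>g \<in> S\<close>] by blast
      have G: "g \<in> carrier G" "g' \<in> carrier G"
        using S that H.mem_carrier[OF g'] by auto
      show ?thesis
        using disj
      proof
        \<comment> \<open>This equation describes conjugation by \<open>inv x\<close>. Passing to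
          conjugation by \<open>x\<close> costs \<open>x \<otimes> x\<close> on the left and its
          inverse on the right, both in \<open>?H\<close>.\<close>
        assume "g \<otimes> x = x \<otimes> g'"
        then have g: "g = x \<otimes> g' \<otimes> inv x"
          using G x by (intro inv_solve_right[THEN iffD2]) auto
        have "x \<otimes> g \<otimes> inv x = (x \<otimes> x) \<otimes> g' \<otimes> inv (x \<otimes> x)"
          unfolding g using x G(2) by (simp add: m_assoc inv_mult_group)
        then show ?thesis using sq g' by simp
      next
        assume "x \<otimes> g = g' \<otimes> x"
        then have "x \<otimes> g \<otimes> inv x = g'"
          using G x by (intro inv_solve_right'[THEN iffD2]) auto
        then show ?thesis using g' by simp
      qed
    qed
    show "x \<otimes> g \<otimes> inv x \<in> ?H" if "g \<in> S" for g
      using *[OF that] .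
    show "x \<otimes> inv g \<otimes> inv x \<in> ?H" if "g \<in> S" for g
    proof -
      have "x \<otimes> inv g \<otimes> inv x = inv (x \<otimes> g \<otimes> inv x)"
        using that S x by (auto simp: inv_mult_group m_assoc subset_iff)
      then show ?thesis using *[OF that] by simp
    qed
  next
    case (eng g h)
    have "x \<otimes> (g \<otimes> h) \<otimes> inv x = (x \<otimes> g \<otimes> inv x) \<otimes> (x \<otimes> h \<otimes> inv x)"
      using x H.mem_carrier[OF eng.hyps(1)] H.mem_carrier[OF eng.hyps(2)]
      by (simp add: m_assoc cancel)
    then show ?case using eng.IH by simp
  qed
  \<comment> \<open>Conjugation by \<open>inv x\<close> is conjugation by \<open>x\<close> followed
    by conjugation by \<open>inv (x \<otimes> x)\<close>, an element of \<open>?H\<close>.\<close>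
  have "inv x \<otimes> h \<otimes> x = inv (x \<otimes> x) \<otimes> (x \<otimes> h \<otimes> inv x) \<otimes> (x \<otimes> x)"
    using x H.mem_carrier[OF h] by (simp add: m_assoc inv_mult_group cancel)
  then show "inv x \<otimes> h \<otimes> x \<in> ?H"
    using sq conj' by simp
qed

section \<open>Normal braid theories\<close>

locale normal_braids =
  fixes \<Theta> :: "('a, 'm) braid_theory_scheme" and n :: nat and x :: 'a
  assumes wf: "generalized_braid_theory \<Theta>" and normal: "normal_theory \<Theta> n x"
begin

lemma group_braids: "group (gB \<Theta> n)"
  using normal wf by (intro group_gB) (simp_all add: normal_theory_def)

sublocale group "gB \<Theta> n"
  by (rule group_braids)

lemma dominant_label: "x \<in> tags \<Theta>" "x \<in> labels \<Theta>"
  using normal by (simp_all add: normal_theory_def dominant_def labels_def)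

lemma letter_diagram: "a \<in> labels \<Theta> \<Longrightarrow> i \<in> {1..<n} \<Longrightarrow> [(a, i)] \<in> diagrams \<Theta> n"
  by (simp add: diagrams_def)

lemma crossing_closed: "a \<in> labels \<Theta> \<Longrightarrow> i \<in> {1..<n} \<Longrightarrow> crossing \<Theta> n a i \<in> carrier (gB \<Theta> n)"
  using letter_diagram by (auto simp: crossing_def carrier_gB[OF wf])

lemma braid_move: "(p, q) \<in> elementary_moves \<Theta> n \<Longrightarrow> braid \<Theta> n p = braid \<Theta> n q"
  using elementary_moves_diagrams[OF wf, of p q n] braid_rel.move[of p q \<Theta> n "[]" "[]"]
  by (simp add: braid_eq_iff[OF wf] diagrams_def)

lemma crossing_far_comm:
  assumes "a \<in> labels \<Theta>" and "b \<in> labels \<Theta>" and "i \<in> {1..<n}" and "j \<in> {1..<n}"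
    and "i + 1 < j \<or> j + 1 < i"
  shows "crossing \<Theta> n a i \<otimes>\<^bsub>gB \<Theta> n\<^esub> crossing \<Theta> n b j =
    crossing \<Theta> n b j \<otimes>\<^bsub>gB \<Theta> n\<^esub> crossing \<Theta> n a i"
  using braid_move[OF elementary_moves.far[OF assms]] assms
  by (simp add: crossing_def mult_gB[OF wf] letter_diagram)

lemma crossing_bar:
  assumes "a \<in> tags \<Theta>" and "i \<in> {1..<n}"
  shows "crossing \<Theta> n (bar \<Theta> a) i = inv\<^bsub>gB \<Theta> n\<^esub> (crossing \<Theta> n a i)"
proof -
  have "a \<in> R2 \<Theta>" "a \<in> labels \<Theta>" "bar \<Theta> a \<in> labels \<Theta>"
    using assms normal by (auto simp: normal_theory_def regular_def labels_def)
  then have "crossing \<Theta> n (bar \<Theta> a) i \<otimes>\<^bsub>gB \<Theta> n\<^esub> crossing \<Theta> n a i = \<one>\<^bsub>gB \<Theta> n\<^esub>"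
    using braid_move[OF elementary_moves.R2_right[of a \<Theta> i n]] assms
    by (simp add: crossing_def mult_gB[OF wf] one_gB[OF wf] letter_diagram)
  then show ?thesis
    using \<open>a \<in> labels \<Theta>\<close> \<open>bar \<Theta> a \<in> labels \<Theta>\<close> assms(2)
    by (metis crossing_closed inv_equality)
qed

lemma dominance:
  assumes "a \<in> labels \<Theta>" and "1 \<le> i" and "i + 1 < n"
  shows "crossing \<Theta> n x (i + 1) \<otimes>\<^bsub>gB \<Theta> n\<^esub> crossing \<Theta> n x i \<otimes>\<^bsub>gB \<Theta> n\<^esub> crossing \<Theta> n a (i + 1) =
    crossing \<Theta> n a i \<otimes>\<^bsub>gB \<Theta> n\<^esub> crossing \<Theta> n x (i + 1) \<otimes>\<^bsub>gB \<Theta> n\<^esub> crossing \<Theta> n x i"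
  using normal assms by (simp add: normal_theory_def dominant_def del: One_nat_def add_Suc_right)

sublocale braid_family_group "gB \<Theta> n" "crossing \<Theta> n x" n
proof unfold_locales
  fix i assume i: "1 \<le> i" "i + 1 < n"
  show "crossing \<Theta> n x i \<otimes>\<^bsub>gB \<Theta> n\<^esub> crossing \<Theta> n x (i + 1) \<otimes>\<^bsub>gB \<Theta> n\<^esub> crossing \<Theta> n x i =
      crossing \<Theta> n x (i + 1) \<otimes>\<^bsub>gB \<Theta> n\<^esub> crossing \<Theta> n x i \<otimes>\<^bsub>gB \<Theta> n\<^esub> crossing \<Theta> n x (i + 1)"
    \<comment> \<open>The braid relation of the dominant crossings is dominance with
      \<open>a = x\<close>.\<close>
    using dominance[OF dominant_label(2) i] by simp
qed (use crossing_closed crossing_far_comm dominant_label in blast)+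

lemma braid_Cons:
  assumes "a \<in> labels \<Theta>" and "i \<in> {1..<n}" and "w \<in> diagrams \<Theta> n"
  shows "braid \<Theta> n ((a, i) # w) = crossing \<Theta> n a i \<otimes>\<^bsub>gB \<Theta> n\<^esub> braid \<Theta> n w"
  using assms by (simp add: crossing_def mult_gB[OF wf] letter_diagram)

section \<open>The generators as bands of double crossings\<close>

lemma xword_eq: "j \<le> n \<Longrightarrow> xword \<Theta> n x i j = word_prod [i + 1..<j]"
proof -
  have "braid \<Theta> n (map (\<lambda>k. (x, k)) w) = word_prod w" if "w \<in> lists {1..<n}" for w
    using that
  proof (induction w)
    case (Cons i w)
    then have "map (\<lambda>k. (x, k)) w \<in> diagrams \<Theta> n"
      using dominant_label by (auto simp: diagrams_def)
    then show ?case
      using Cons dominant_label by (simp add: braid_Cons)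
  qed (simp add: one_gB[OF wf])
  moreover assume "j \<le> n"
  then have "[i + 1..<j] \<in> lists {1..<n}" by auto
  ultimately show ?thesis by (simp add: xword_def)
qed

text \<open>The two orders of a double crossing, for every tag including \<open>x\<close>, where
  both are the square \<open>x_i^2\<close>. Keeping \<open>x\<close> here merges the three kinds of
  generators into one.\<close>

definition doubles :: "(nat \<Rightarrow> ('a \<times> nat) list set) set" where
  "doubles = (\<Union>a\<in>tags \<Theta>. {\<lambda>i. crossing \<Theta> n a i \<otimes>\<^bsub>gB \<Theta> n\<^esub> crossing \<Theta> n x i,
     \<lambda>i. crossing \<Theta> n x i \<otimes>\<^bsub>gB \<Theta> n\<^esub> crossing \<Theta> n a i})"

lemma doublesE:
  assumes "u \<in> doubles"
  obtains a where "a \<in> tags \<Theta>" and "u = (\<lambda>i. crossing \<Theta> n a i \<otimes>\<^bsub>gB \<Theta> n\<^esub> crossing \<Theta> n x i)"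
  | a where "a \<in> tags \<Theta>" and "u = (\<lambda>i. crossing \<Theta> n x i \<otimes>\<^bsub>gB \<Theta> n\<^esub> crossing \<Theta> n a i)"
  using assms by (auto simp: doubles_def)

lemma lam_gens_eq:
  "lam_gens \<Theta> n x = {band u i j | u i j. u \<in> doubles \<and> 1 \<le> i \<and> i < j \<and> j \<le> n}"
proof -
  have upper: "lam \<Theta> n x a i j = band (\<lambda>i. crossing \<Theta> n a i \<otimes>\<^bsub>gB \<Theta> n\<^esub> crossing \<Theta> n x i) i j"
    and lower: "lam \<Theta> n x a j i = band (\<lambda>i. crossing \<Theta> n x i \<otimes>\<^bsub>gB \<Theta> n\<^esub> crossing \<Theta> n a i) i j"
    if "i < j" "j \<le> n" for a i j
    using that by (simp_all add: lam_def band_def xword_eq)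
  show ?thesis (is "_ = ?B")
  proof (intro equalityI subsetI)
    fix g assume "g \<in> lam_gens \<Theta> n x"
    then show "g \<in> ?B"
      unfolding lam_gens_def
    proof (elim UnE CollectE exE conjE)
      fix a i j assume *: "g = lam \<Theta> n x a i j" "a \<in> tags \<Theta> - {x}" "1 \<le> i" "i < j" "j \<le> n"
      then show ?thesis
        unfolding *(1) upper[OF *(4,5)] by (auto simp: doubles_def)
    next
      fix a i j assume *: "g = lam \<Theta> n x a j i" "a \<in> tags \<Theta> - {x}" "1 \<le> i" "i < j" "j \<le> n"
      then show ?thesis
        unfolding *(1) lower[OF *(4,5)] by (auto simp: doubles_def)
    next
      fix i j assume *: "g = lam \<Theta> n x x i j" "1 \<le> i" "i < j" "j \<le> n"
      then show ?thesis
        unfolding *(1) upper[OF *(3,4)] using dominant_label by (auto simp: doubles_def)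
    qed
  next
    fix g assume "g \<in> ?B"
    then obtain u i j where u: "u \<in> doubles" and ij: "1 \<le> i" "i < j" "j \<le> n" and g: "g = band u i j"
      by blast
    from u show "g \<in> lam_gens \<Theta> n x"
    proof (cases rule: doublesE)
      case (1 a)
      then have "g = lam \<Theta> n x a i j"
        using upper ij g by simp
      then show ?thesis
        unfolding lam_gens_def using 1(1) ij by (cases "a = x") blast+
    next
      case (2 a)
      \<comment> \<open>For \<open>a = x\<close> the two orders coincide, so the reversed generator
        is identified with the third kind, which is listed only for \<open>i < j\<close>.\<close>
      then have "g = lam \<Theta> n x a j i" and "a = x \<Longrightarrow> g = lam \<Theta> n x x i j"
        using upper[of i j x] lower ij g by simp_all
      then show ?thesis
        unfolding lam_gens_def using 2(1) ij by (cases "a = x") blast+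
    qed
  qed
qed

lemma slides_crossing:
  assumes "a \<in> labels \<Theta>"
  shows "slides (crossing \<Theta> n a)"
  unfolding slides_def
  using assms dominant_label crossing_closed crossing_far_comm dominance by fastforce

lemma slides_doubles: "u \<in> doubles \<Longrightarrow> slides u"
  using dominant_label by (auto simp: labels_def elim!: doublesE intro!: slides_mult slides_crossing)

lemma lam_gens_closed: "lam_gens \<Theta> n x \<subseteq> carrier (gB \<Theta> n)"
  unfolding lam_gens_eq using band_closed[OF slides_doubles] by blast

section \<open>Normality of the subgroup generated by the lambdas\<close>

abbreviation lam_subgroup :: "('a \<times> nat) list set set" where
  "lam_subgroup \<equiv> generate (gB \<Theta> n) (lam_gens \<Theta> n x)"

lemma subgroup_lam: "subgroup lam_subgroup (gB \<Theta> n)"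
  by (rule generate_is_subgroup[OF lam_gens_closed])

lemma double_in_lam:
  assumes "u \<in> doubles" and "i \<in> {1..<n}"
  shows "u i \<in> lam_subgroup"
proof -
  have "band u i (i + 1) \<in> lam_gens \<Theta> n x"
    unfolding lam_gens_eq using assms by fastforce
  then show ?thesis
    using band_adjacent[OF slides_doubles[OF assms(1)] assms(2)] by (simp add: generate.incl)
qed

lemma crossings_in_lam:
  assumes "a \<in> tags \<Theta>" and "i \<in> {1..<n}"
  shows "crossing \<Theta> n a i \<otimes>\<^bsub>gB \<Theta> n\<^esub> crossing \<Theta> n x i \<in> lam_subgroup"
    and "crossing \<Theta> n x i \<otimes>\<^bsub>gB \<Theta> n\<^esub> crossing \<Theta> n a i \<in> lam_subgroup"
  by (rule double_in_lam[OF _ assms(2)]; use assms(1) in \<open>auto simp: doubles_def\<close>)+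

lemma lam_gens_conjugation:
  assumes "g \<in> lam_gens \<Theta> n x" and k: "k \<in> {1..<n}"
  shows "\<exists>g'\<in>lam_subgroup. g \<otimes>\<^bsub>gB \<Theta> n\<^esub> crossing \<Theta> n x k = crossing \<Theta> n x k \<otimes>\<^bsub>gB \<Theta> n\<^esub> g' \<or>
    crossing \<Theta> n x k \<otimes>\<^bsub>gB \<Theta> n\<^esub> g = g' \<otimes>\<^bsub>gB \<Theta> n\<^esub> crossing \<Theta> n x k"
proof -
  obtain u i j where u: "u \<in> doubles" and ij: "1 \<le> i" "i < j" "j \<le> n" and g: "g = band u i j"
    using assms(1) unfolding lam_gens_eq by blast
  show ?thesis
  proof (cases "k = i \<and> j = i + 1")
    \<comment> \<open>The case left out of \<open>band_conjugation\<close>: \<open>x_k\<close>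
      exchanges the two orders \<open>a_k x_k\<close> and \<open>x_k a_k\<close>.\<close>
    case True
    then have g: "g = u k"
      using g k band_adjacent[OF slides_doubles[OF u]] by simp
    have G: "crossing \<Theta> n a k \<in> carrier (gB \<Theta> n)" if "a \<in> tags \<Theta>" for a
      using that k by (simp add: crossing_closed labels_def)
    from u show ?thesis
    proof (cases rule: doublesE)
      case (1 a)
      then have "crossing \<Theta> n x k \<otimes>\<^bsub>gB \<Theta> n\<^esub> g =
          (crossing \<Theta> n x k \<otimes>\<^bsub>gB \<Theta> n\<^esub> crossing \<Theta> n a k) \<otimes>\<^bsub>gB \<Theta> n\<^esub> crossing \<Theta> n x k"
        using g G dominant_label by (simp add: m_assoc)
      then show ?thesis
        using crossings_in_lam(2)[OF 1(1) k] by blast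
    next
      case (2 a)
      then have "g \<otimes>\<^bsub>gB \<Theta> n\<^esub> crossing \<Theta> n x k =
          crossing \<Theta> n x k \<otimes>\<^bsub>gB \<Theta> n\<^esub> (crossing \<Theta> n a k \<otimes>\<^bsub>gB \<Theta> n\<^esub> crossing \<Theta> n x k)"
        using g G dominant_label by (simp add: m_assoc)
      then show ?thesis
        using crossings_in_lam(1)[OF 2(1) k] by blast
    qed
  next
    case False
    have "band u i' j' \<in> lam_subgroup" if "1 \<le> i'" "i' < j'" "j' \<le> n" for i' j'
      using that u lam_gens_eq by (blast intro: generate.incl)
    then show ?thesis
      using band_conjugation[OF slides_doubles[OF u] ij k False] g by blast
  qed
qed

text \<open>Every braid is a product of crossings, and each crossing is, in some order, a product of
  a subgroup element and \<open>x_i\<close> or its inverse. So conjugation by the \<open>x_i\<close>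
  and their inverses decides normality.\<close>

lemma normal_lam: "lam_subgroup \<lhd> gB \<Theta> n"
proof -
  interpret H: subgroup lam_subgroup "gB \<Theta> n" by (rule subgroup_lam)
  \<comment> \<open>\<open>N\<close> asks only that \<open>g\<close> conjugate the subgroup into
    itself, which gives closure under products but not at once under inverses; so \<open>x_i\<close>
    and its inverse are placed in \<open>N\<close> separately.\<close>
  define N where "N = {g \<in> carrier (gB \<Theta> n).
    \<forall>h\<in>lam_subgroup. g \<otimes>\<^bsub>gB \<Theta> n\<^esub> h \<otimes>\<^bsub>gB \<Theta> n\<^esub> inv\<^bsub>gB \<Theta> n\<^esub> g \<in> lam_subgroup}"
  have N_mult: "g \<otimes>\<^bsub>gB \<Theta> n\<^esub> g' \<in> N" if "g \<in> N" "g' \<in> N" for g g'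
  proof -
    have "(g \<otimes>\<^bsub>gB \<Theta> n\<^esub> g') \<otimes>\<^bsub>gB \<Theta> n\<^esub> h \<otimes>\<^bsub>gB \<Theta> n\<^esub> inv\<^bsub>gB \<Theta> n\<^esub> (g \<otimes>\<^bsub>gB \<Theta> n\<^esub> g') =
        g \<otimes>\<^bsub>gB \<Theta> n\<^esub> (g' \<otimes>\<^bsub>gB \<Theta> n\<^esub> h \<otimes>\<^bsub>gB \<Theta> n\<^esub> inv\<^bsub>gB \<Theta> n\<^esub> g') \<otimes>\<^bsub>gB \<Theta> n\<^esub> inv\<^bsub>gB \<Theta> n\<^esub> g"
      if "h \<in> lam_subgroup" for h
      using \<open>g \<in> N\<close> \<open>g' \<in> N\<close> H.mem_carrier[OF that] by (simp add: N_def m_assoc inv_mult_group)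
    then show ?thesis
      using that by (simp add: N_def)
  qed
  have N_lam: "h \<in> N" if "h \<in> lam_subgroup" for h
    using that by (simp add: N_def)
  have sq: "crossing \<Theta> n x i \<otimes>\<^bsub>gB \<Theta> n\<^esub> crossing \<Theta> n x i \<in> lam_subgroup" if "i \<in> {1..<n}" for i
    using crossings_in_lam dominant_label that by blast
  have N_x: "crossing \<Theta> n x i \<in> N" "inv\<^bsub>gB \<Theta> n\<^esub> crossing \<Theta> n x i \<in> N" if i: "i \<in> {1..<n}" for i
    using generate_conjugation_closed[OF lam_gens_closed s_closed[OF i] sq[OF i] lam_gens_conjugation[OF _ i]]
      s_closed[OF i] by (simp_all add: N_def)
  have N_crossing: "crossing \<Theta> n a i \<in> N" if a: "a \<in> labels \<Theta>" and i: "i \<in> {1..<n}" for a i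
  proof (cases "a \<in> tags \<Theta>")
    case True
    have "crossing \<Theta> n a i =
        (crossing \<Theta> n a i \<otimes>\<^bsub>gB \<Theta> n\<^esub> crossing \<Theta> n x i) \<otimes>\<^bsub>gB \<Theta> n\<^esub> inv\<^bsub>gB \<Theta> n\<^esub> crossing \<Theta> n x i"
      using crossing_closed[OF a i] s_closed[OF i] by (simp add: m_assoc)
    also have "\<dots> \<in> N"
      by (intro N_mult N_lam N_x crossings_in_lam True i)
    finally show ?thesis .
  next
    case False
    then obtain b where b: "b \<in> tags \<Theta>" "a = bar \<Theta> b"
      using a by (auto simp: labels_def)
    then have G: "crossing \<Theta> n b i \<in> carrier (gB \<Theta> n)"
      using i by (simp add: crossing_closed labels_def)
    \<comment> \<open>For a negative label the crossing is the inverse of \<open>b_i\<close>, and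
      \<open>b_i^-1 = x_i (b_i x_i)^-1\<close>.\<close>
    have "crossing \<Theta> n a i =
        crossing \<Theta> n x i \<otimes>\<^bsub>gB \<Theta> n\<^esub> inv\<^bsub>gB \<Theta> n\<^esub> (crossing \<Theta> n b i \<otimes>\<^bsub>gB \<Theta> n\<^esub> crossing \<Theta> n x i)"
      using G s_closed[OF i] by (simp add: b(2) crossing_bar[OF b(1) i] inv_mult_group flip: m_assoc)
    also have "\<dots> \<in> N"
      by (intro N_mult N_lam N_x H.m_inv_closed crossings_in_lam b(1) i)
    finally show ?thesis .
  qed
  have "braid \<Theta> n w \<in> N" if "w \<in> diagrams \<Theta> n" for w
    using that
  proof (induction w)
    case Nil
    show ?case using N_lam[OF H.one_closed] by (simp add: one_gB[OF wf])
  next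
    case (Cons l w)
    then show ?case
      by (cases l) (auto simp: diagrams_def braid_Cons intro!: N_mult N_crossing)
  qed
  then show ?thesis
    unfolding normal_inv_iff by (auto simp: subgroup_lam carrier_gB[OF wf] N_def)
qed

section \<open>The quotient and its Coxeter relations\<close>

lemma coset_crossing:
  assumes a: "a \<in> labels \<Theta>" and i: "i \<in> {1..<n}"
  shows "lam_subgroup #>\<^bsub>gB \<Theta> n\<^esub> crossing \<Theta> n a i = lam_subgroup #>\<^bsub>gB \<Theta> n\<^esub> crossing \<Theta> n x i"
proof -
  interpret H: subgroup lam_subgroup "gB \<Theta> n" by (rule subgroup_lam)
  note x = s_closed[OF i]
  have coset: "lam_subgroup #>\<^bsub>gB \<Theta> n\<^esub> g = lam_subgroup #>\<^bsub>gB \<Theta> n\<^esub> crossing \<Theta> n x i"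
    if "g \<in> carrier (gB \<Theta> n)" "crossing \<Theta> n x i \<otimes>\<^bsub>gB \<Theta> n\<^esub> inv\<^bsub>gB \<Theta> n\<^esub> g \<in> lam_subgroup" for g
  proof (rule repr_independence[OF _ that(1) subgroup_lam])
    have "crossing \<Theta> n x i = crossing \<Theta> n x i \<otimes>\<^bsub>gB \<Theta> n\<^esub> inv\<^bsub>gB \<Theta> n\<^esub> g \<otimes>\<^bsub>gB \<Theta> n\<^esub> g"
      using that x by (simp add: m_assoc)
    then show "crossing \<Theta> n x i \<in> lam_subgroup #>\<^bsub>gB \<Theta> n\<^esub> g"
      using that(2) unfolding r_coset_def by blast
  qed
  show ?thesis
  proof (cases "a \<in> tags \<Theta>")
    case True
    note G = crossing_closed[OF a i]
    \<comment> \<open>Inserting \<open>x_i\<close> expresses \<open>x_i a_i^-1\<close> through two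
      double crossings, \<open>x_i x_i\<close> and \<open>a_i x_i\<close>.\<close>
    have "crossing \<Theta> n x i \<otimes>\<^bsub>gB \<Theta> n\<^esub> inv\<^bsub>gB \<Theta> n\<^esub> crossing \<Theta> n a i =
        (crossing \<Theta> n x i \<otimes>\<^bsub>gB \<Theta> n\<^esub> crossing \<Theta> n x i) \<otimes>\<^bsub>gB \<Theta> n\<^esub>
        inv\<^bsub>gB \<Theta> n\<^esub> (crossing \<Theta> n a i \<otimes>\<^bsub>gB \<Theta> n\<^esub> crossing \<Theta> n x i)"
      using G x by (simp add: inv_mult_group m_assoc) (simp flip: m_assoc)
    also have "\<dots> \<in> lam_subgroup"
      by (intro H.m_closed H.m_inv_closed crossings_in_lam dominant_label True i)
    finally show ?thesis using coset[OF G] by blast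
  next
    case False
    then obtain b where b: "b \<in> tags \<Theta>" "a = bar \<Theta> b"
      using a by (auto simp: labels_def)
    then have "crossing \<Theta> n b i \<in> carrier (gB \<Theta> n)"
      using i by (simp add: crossing_closed labels_def)
    \<comment> \<open>Here \<open>a_i\<close> is the inverse of \<open>b_i\<close>, so the element
      to test is \<open>x_i b_i\<close>, itself a double crossing.\<close>
    then show ?thesis
      using crossings_in_lam(2)[OF b(1) i] by (intro coset) (simp_all add: b(2) crossing_bar[OF b(1) i])
  qed
qed

lemma coset_coxeter_family:
  "coxeter_family (gB \<Theta> n Mod lam_subgroup) (\<lambda>i. lam_subgroup #>\<^bsub>gB \<Theta> n\<^esub> crossing \<Theta> n x i) n"
proof -
  interpret N: normal lam_subgroup "gB \<Theta> n" by (rule normal_lam)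
  interpret Q: group "gB \<Theta> n Mod lam_subgroup" by (rule N.factorgroup_is_group)
  show ?thesis
  proof unfold_locales
    fix i assume "i \<in> {1..<n}"
    then show "lam_subgroup #>\<^bsub>gB \<Theta> n\<^esub> crossing \<Theta> n x i \<in> carrier (gB \<Theta> n Mod lam_subgroup)"
      unfolding carrier_FactGroup using s_closed by blast
  next
    fix i j assume "i \<in> {1..<n}" "j \<in> {1..<n}" "i + 1 < j"
    then show "(lam_subgroup #>\<^bsub>gB \<Theta> n\<^esub> crossing \<Theta> n x i) \<otimes>\<^bsub>gB \<Theta> n Mod lam_subgroup\<^esub>
        (lam_subgroup #>\<^bsub>gB \<Theta> n\<^esub> crossing \<Theta> n x j) =
        (lam_subgroup #>\<^bsub>gB \<Theta> n\<^esub> crossing \<Theta> n x j) \<otimes>\<^bsub>gB \<Theta> n Mod lam_subgroup\<^esub>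
        (lam_subgroup #>\<^bsub>gB \<Theta> n\<^esub> crossing \<Theta> n x i)"
      using far_comm[of i j] by (simp add: N.rcos_sum s_closed)
  next
    fix i assume i: "1 \<le> i" "i + 1 < n"
    then have "i \<in> {1..<n}" "i + 1 \<in> {1..<n}" by auto
    then show "(lam_subgroup #>\<^bsub>gB \<Theta> n\<^esub> crossing \<Theta> n x i) \<otimes>\<^bsub>gB \<Theta> n Mod lam_subgroup\<^esub>
        (lam_subgroup #>\<^bsub>gB \<Theta> n\<^esub> crossing \<Theta> n x (i + 1)) \<otimes>\<^bsub>gB \<Theta> n Mod lam_subgroup\<^esub>
        (lam_subgroup #>\<^bsub>gB \<Theta> n\<^esub> crossing \<Theta> n x i) =
        (lam_subgroup #>\<^bsub>gB \<Theta> n\<^esub> crossing \<Theta> n x (i + 1)) \<otimes>\<^bsub>gB \<Theta> n Mod lam_subgroup\<^esub>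
        (lam_subgroup #>\<^bsub>gB \<Theta> n\<^esub> crossing \<Theta> n x i) \<otimes>\<^bsub>gB \<Theta> n Mod lam_subgroup\<^esub>
        (lam_subgroup #>\<^bsub>gB \<Theta> n\<^esub> crossing \<Theta> n x (i + 1))"
      using braid_eq[OF i] s_closed[of i] s_closed[of "i + 1"]
      by (simp only: mult_FactGroup N.rcos_sum m_closed)
  next
    fix i assume i: "i \<in> {1..<n}"
    then show "(lam_subgroup #>\<^bsub>gB \<Theta> n\<^esub> crossing \<Theta> n x i) \<otimes>\<^bsub>gB \<Theta> n Mod lam_subgroup\<^esub>
        (lam_subgroup #>\<^bsub>gB \<Theta> n\<^esub> crossing \<Theta> n x i) = \<one>\<^bsub>gB \<Theta> n Mod lam_subgroup\<^esub>"
      \<comment> \<open>\<open>x_i^2\<close> is the double crossing with label \<open>x\<close>, so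
        its coset is trivial.\<close>
      using crossings_in_lam(1)[OF dominant_label(1) i] subgroup_lam
      by (simp add: N.rcos_sum s_closed coset_join2)
  qed
qed

text \<open>Modulo the subgroup only the positions of a diagram survive, not its labels, so the
  diagram becomes a word in Coxeter generators; the identity permutation makes this word
  trivial.\<close>

lemma gPB_subset_lam: "gPB \<Theta> n \<subseteq> lam_subgroup"
proof
  interpret N: normal lam_subgroup "gB \<Theta> n" by (rule normal_lam)
  interpret Q: coxeter_family "gB \<Theta> n Mod lam_subgroup"
    "\<lambda>i. lam_subgroup #>\<^bsub>gB \<Theta> n\<^esub> crossing \<Theta> n x i" n
    by (rule coset_coxeter_family)
  have coset: "lam_subgroup #>\<^bsub>gB \<Theta> n\<^esub> braid \<Theta> n w = Q.word_prod (map snd w)"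
    if "w \<in> diagrams \<Theta> n" for w
    using that
  proof (induction w)
    case Nil
    show ?case
      using coset_join2[OF one_closed subgroup_lam] by (simp add: one_gB[OF wf, symmetric])
  next
    case (Cons l w)
    obtain a i where l: "l = (a, i)" by force
    then have ai: "a \<in> labels \<Theta>" "i \<in> {1..<n}" and w: "w \<in> diagrams \<Theta> n"
      using Cons.prems by (auto simp: diagrams_def)
    have "braid \<Theta> n w \<in> carrier (gB \<Theta> n)"
      using w by (simp add: carrier_gB[OF wf])
    then show ?case
      using Cons.IH[OF w] ai w
      by (simp add: l braid_Cons coset_crossing crossing_closed flip: N.rcos_sum)
  qed
  have perm: "diagram_perm w = word_perm (map snd w)" for w :: "('a \<times> nat) list"
    by (induction w) (auto simp del: One_nat_def)
  fix g assume "g \<in> gPB \<Theta> n"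
  then obtain w where w: "w \<in> diagrams \<Theta> n" and g: "g = braid \<Theta> n w" and "diagram_perm w = id"
    by (auto simp: gPB_def kernel_def carrier_gB[OF wf] braid_perm_braid[OF wf] sym_group_one)
  moreover from w have "map snd w \<in> lists {1..<n}"
    by (fastforce simp: diagrams_def)
  ultimately have "lam_subgroup #>\<^bsub>gB \<Theta> n\<^esub> g = lam_subgroup"
    using Q.word_prod_eq_one[of "map snd w"] by (simp add: coset perm)
  moreover have "g \<in> carrier (gB \<Theta> n)"
    using w by (simp add: g carrier_gB[OF wf])
  ultimately show "g \<in> lam_subgroup"
    using subgroup_lam by (rule coset_join1)
qed

text \<open>A double crossing returns both strands to their places and is therefore pure; the bands
  follow because a kernel is closed under conjugation.\<close>

lemma lam_subset_gPB: "lam_subgroup \<subseteq> gPB \<Theta> n"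
proof -
  interpret P: group_hom "gB \<Theta> n" "sym_group n" braid_perm
    by (rule group_hom.intro[OF group_braids sym_group_is_group group_hom_axioms.intro[OF braid_perm_hom[OF wf]]])
  have crossings: "crossing \<Theta> n a i \<otimes>\<^bsub>gB \<Theta> n\<^esub> crossing \<Theta> n b i \<in> gPB \<Theta> n"
    if "a \<in> labels \<Theta>" "b \<in> labels \<Theta>" "i \<in> {1..<n}" for a b i
    using that by (simp add: gPB_def kernel_def crossing_closed braid_perm_crossing[OF wf]
        sym_group_mult sym_group_one del: One_nat_def)
  interpret K: normal "gPB \<Theta> n" "gB \<Theta> n"
    unfolding gPB_def by (rule P.normal_kernel)
  have "u i \<in> gPB \<Theta> n" if "u \<in> doubles" "i \<in> {1..<n}" for u i
    using that dominant_label by (auto elim!: doublesE intro!: crossings simp: labels_def)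
  then have "lam_gens \<Theta> n x \<subseteq> gPB \<Theta> n"
    unfolding lam_gens_eq band_def using run_closed K.inv_op_closed1 by auto
  then show ?thesis
    using K.subgroup_axioms by (rule generate_subgroup_incl)
qed

end

theorem theorem3p3:
  fixes \<Theta> :: "'a braid_theory" and n :: nat and x :: 'a
  assumes "n \<ge> 2"
    and "generalized_braid_theory \<Theta>"
    and "normal_theory \<Theta> n x"
  shows "generate (gB \<Theta> n) (lam_gens \<Theta> n x) = gPB \<Theta> n"
proof -
  interpret normal_braids \<Theta> n x
    using assms by unfold_locales
  show ?thesis
    using lam_subset_gPB gPB_subset_lam by (rule equalityI)
qed

end
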